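(* There exist a constant $c>0$ and, for infinitely many $n$, a simple undirected unweighted graph $G$ on $n$ nodes together with an initial coloring of its nodes with two colors, such that in the sequential adversarial model the minority process on $G$ admits a sequence of at least $c\,n^2$ valid steps (i.e., the stabilization time in the sequential adversarial model is $\Omega(n^2)$).
   Context: Let $G$ be a simple, unweighted, undirected graph whose nodes are colored with two colors (black and white). A node $v$ is switchable in the current coloring if, with $v$ currently colored $c_1$, the other color $c_2$ occurs strictly fewer times than $c_1$ among the neighbors of $v$; switching $v$ means changing its color to the color least frequent in its neighborhood (with two colors: to the other color). The minority process is a sequence of steps, each step consisting of a set of nodes that switch simultaneously; a step is valid only if every chosen node is switchable in the coloring before the step. A coloring is stable if no node is switchable, and the stabilization time is the number of steps until a stable coloring is reached. In the sequential adversarial model, each step switches exactly one switchable node, and the order is chosen by an adversary who maximizes the number of steps; thus the stabilization time is the maximum length of a sequence of valid single-node steps. *)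

theory Defs
  imports Complex_Main "Graph_Theory.Pair_Digraph"
begin

text \<open>
  Simple undirected graphs are the \<^locale>\<open>pair_graph\<close>s of the graph library: finite, loop-free,
  with a symmetric set of arcs, so that each undirected edge is given by its two orientations.
  A coloring is a total function on the vertex type; only its values on the vertices matter.
\<close>

datatype color = Black | White

fun other :: "color \<Rightarrow> color" where
  "other Black = White"
| "other White = Black"

definition neighbors :: "'a pair_pre_digraph \<Rightarrow> 'a \<Rightarrow> 'a set" where
  "neighbors G v = {u. (v, u) \<in> parcs G}"

definition switchable :: "'a pair_pre_digraph \<Rightarrow> ('a \<Rightarrow> color) \<Rightarrow> 'a \<Rightarrow> bool" where
  "switchable G f v \<longleftrightarrow> v \<in> pverts G \<and>
     card {u \<in> neighbors G v. f u = other (f v)} < card {u \<in> neighbors G v. f u = f v}"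

definition switch :: "'a set \<Rightarrow> ('a \<Rightarrow> color) \<Rightarrow> 'a \<Rightarrow> color" where
  "switch S f v = (if v \<in> S then other (f v) else f v)"

fun valid_steps :: "'a pair_pre_digraph \<Rightarrow> ('a \<Rightarrow> color) \<Rightarrow> 'a set list \<Rightarrow> bool" where
  "valid_steps G f [] \<longleftrightarrow> True"
| "valid_steps G f (S # Ss) \<longleftrightarrow> (\<forall>v\<in>S. switchable G f v) \<and> valid_steps G (switch S f) Ss"

definition sequential_steps ::
    "'a pair_pre_digraph \<Rightarrow> ('a \<Rightarrow> color) \<Rightarrow> 'a set list \<Rightarrow> bool" where
  "sequential_steps G f Ss \<longleftrightarrow> valid_steps G f Ss \<and> (\<forall>S\<in>set Ss. is_singleton S)"

end

theory Submission
  imports Defs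
begin

text \<open>
  A set \<open>X\<close> of \<open>2k + 1\<close> nodes of alternating colors is joined completely to an independent set
  \<open>Y\<close> of \<open>k\<close> nodes. Each node of \<open>X\<close> has in addition \<open>k + 1\<close> neighbors of its own color that
  never move, so whatever happens in \<open>Y\<close> it can switch once, at a moment of the adversary's choice.
  Switching the nodes of \<open>X\<close> one at a time in the alternating order moves the majority color in
  \<open>X\<close> back and forth between \<open>k + 1\<close> white and \<open>k + 1\<close> black nodes, and each time all of \<open>Y\<close>
  can follow. This makes \<open>2k (k + 1)\<close> steps on \<open>5k + 3\<close> nodes.
\<close>

lemma other_other [simp]: "other (other c) = c"
  by (cases c) auto

lemma other_neq [simp]: "other c \<noteq> c" "c \<noteq> other c"
  by (cases c; simp)+

lemma valid_steps_append:
  "valid_steps G f (Ss @ Ts) \<longleftrightarrow> valid_steps G f Ss \<and> valid_steps G (fold switch Ss f) Ts"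
  by (induction Ss arbitrary: f) auto

lemma switchable_cong:
  assumes "f v = g v" "\<And>u. u \<in> neighbors G v \<Longrightarrow> f u = g u"
  shows "switchable G f v = switchable G g v"
proof -
  have "{u \<in> neighbors G v. f u = c} = {u \<in> neighbors G v. g u = c}" for c
    using assms(2) by auto
  then show ?thesis
    using assms(1) by (simp add: switchable_def)
qed

lemma fold_switch_singletons:
  "distinct vs \<Longrightarrow> fold switch (map (\<lambda>v. {v}) vs) f = switch (set vs) f"
  by (induction vs arbitrary: f) (auto simp: switch_def fun_eq_iff)

text \<open>Switching a node affects the switchability only of itself and its neighbors, so in an
  independent set every node still waiting stays switchable.\<close>

lemma valid_steps_independent:
  assumes "distinct vs"
    and "\<And>v. v \<in> set vs \<Longrightarrow> switchable G f v"
    and "\<And>u v. u \<in> set vs \<Longrightarrow> v \<in> set vs \<Longrightarrow> u \<notin> neighbors G v"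
  shows "valid_steps G f (map (\<lambda>v. {v}) vs)"
  using assms
proof (induction vs arbitrary: f)
  case (Cons a vs)
  have "switchable G (switch {a} f) v" if "v \<in> set vs" for v
  proof -
    have "switchable G (switch {a} f) v = switchable G f v"
      using Cons.prems(1,3) that by (intro switchable_cong) (auto simp: switch_def)
    then show ?thesis
      using Cons.prems(2) that by simp
  qed
  then show ?case
    using Cons.prems Cons.IH[of "switch {a} f"] by simp
qed simp

definition col :: "nat \<Rightarrow> color" where
  "col n = (if even n then White else Black)"

lemma col_Suc [simp]: "col (Suc n) = other (col n)"
  by (simp add: col_def)

lemma col_eq_iff: "col m = col n \<longleftrightarrow> even m = even n"
  by (simp add: col_def)

text \<open>\<open>X\<close> is \<open>0..2k\<close>, \<open>Y\<close> is \<open>2k+1..3k\<close>,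
  and the remaining \<open>2k + 2\<close> nodes stay fixed, \<open>k + 1\<close> of each parity.
  They are colored by parity, as \<open>X\<close> is initially, so equal parity means equal initial
  color.\<close>

definition swing_edges :: "nat \<Rightarrow> (nat \<times> nat) set" where
  "swing_edges k =
    {(x, y). x \<le> 2 * k \<and> 2 * k < y \<and> y < 5 * k + 3 \<and> (y \<le> 3 * k \<or> even x = even y)}"

definition swing_graph :: "nat \<Rightarrow> nat pair_pre_digraph" where
  "swing_graph k = \<lparr>pverts = {..<5 * k + 3}, parcs = swing_edges k \<union> (swing_edges k)\<inverse>\<rparr>"

text \<open>The coloring after \<open>i \<le> 2 * k\<close> rounds: \<open>col i\<close> is then the
  majority color in \<open>X\<close>, and \<open>Y\<close> is at rest in the minority color.\<close>

definition swing_coloring :: "nat \<Rightarrow> nat \<Rightarrow> nat \<Rightarrow> color" where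
  "swing_coloring k i v =
    (if v < i then other (col v) else if 2 * k < v \<and> v \<le> 3 * k then other (col i) else col v)"

text \<open>Node \<open>i\<close> tips the majority in \<open>X\<close>, then the nodes of
  \<open>Y\<close> follow one by one.\<close>

definition swing_round :: "nat \<Rightarrow> nat \<Rightarrow> nat set list" where
  "swing_round k i = map (\<lambda>v. {v}) (i # [2 * k + 1..<3 * k + 1])"

lemma pair_graph_swing_graph: "pair_graph (swing_graph k)"
proof
  show "finite (parcs (swing_graph k))"
    by (rule finite_subset[of _ "{..<5 * k + 3} \<times> {..<5 * k + 3}"])
      (auto simp: swing_graph_def swing_edges_def)
  have "sym (parcs (swing_graph k))"
    by (auto simp: swing_graph_def sym_def)
  then show "symmetric (with_proj (swing_graph k))"
    by (simp add: symmetric_def arcs_ends_def arc_to_ends_def)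
qed (auto simp: swing_graph_def swing_edges_def)

lemma neighbors_control:
  assumes "x \<le> 2 * k"
  shows "neighbors (swing_graph k) x =
    {2 * k <..3 * k} \<union> {y. 3 * k < y \<and> y < 5 * k + 3 \<and> even x = even y}"
  using assms by (auto simp: neighbors_def swing_graph_def swing_edges_def)

lemma neighbors_follower:
  assumes "2 * k < y" "y \<le> 3 * k"
  shows "neighbors (swing_graph k) y = {..2 * k}"
  using assms by (auto simp: neighbors_def swing_graph_def swing_edges_def)

text \<open>The interval splits into \<open>m\<close> pairs of consecutive numbers;
  \<open>?h r\<close> picks the member of parity \<open>b\<close> from the pair starting at
  \<open>a + 2 * r\<close>.\<close>

lemma card_parity_interval:
  "card {y::nat. a \<le> y \<and> y < a + 2 * m \<and> even y = b} = m"
proof -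
  let ?h = "\<lambda>r. a + 2 * r + (if even a = b then 0 else 1)"
  have "{y. a \<le> y \<and> y < a + 2 * m \<and> even y = b} = ?h ` {..<m}"
  proof (intro set_eqI iffI)
    fix y
    assume y: "y \<in> {y. a \<le> y \<and> y < a + 2 * m \<and> even y = b}"
    then have "y = ?h ((y - a) div 2)" "(y - a) div 2 < m"
      by (auto; presburger)+
    then show "y \<in> ?h ` {..<m}" by blast
  qed (auto split: if_splits)
  moreover have "inj_on ?h {..<m}"
    by (auto simp: inj_on_def)
  ultimately show ?thesis
    by (simp add: card_image)
qed

text \<open>Going from \<open>i\<close> to \<open>i + 1\<close> moves only node \<open>i\<close>,
  from the majority class to the minority class. The sizes \<open>k + 1\<close> and \<open>k\<close>
  thus swap, just as \<open>col\<close> alternates.\<close>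

lemma card_control_colors:
  assumes "i \<le> 2 * k"
  shows "card {u \<in> {..2 * k}. swing_coloring k i u = col i} = k + 1 \<and>
    card {u \<in> {..2 * k}. swing_coloring k i u = other (col i)} = k"
  using assms
proof (induction i)
  case 0
  \<comment> \<open>The top node \<open>2 * k\<close> is even; splitting it off leaves an interval
    of even length.\<close>
  have white: "{u \<in> {..2 * k}. swing_coloring k 0 u = col 0} =
      insert (2 * k) {y. 0 \<le> y \<and> y < 0 + 2 * k \<and> even y = True}"
    by (auto simp: swing_coloring_def col_eq_iff)
  have black: "{u \<in> {..2 * k}. swing_coloring k 0 u = other (col 0)} =
      {y. 0 \<le> y \<and> y < 0 + 2 * k \<and> even y = False}"
    by (auto simp: swing_coloring_def col_def le_less)
  have "card (insert (2 * k) {y. 0 \<le> y \<and> y < 0 + 2 * k \<and> even y = True}) = Suc k"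
    by (subst card_insert_disjoint, simp, simp, simp only: card_parity_interval)
  then show ?case
    unfolding white black card_parity_interval by simp
next
  case (Suc i)
  let ?S = "\<lambda>i c. {u \<in> {..2 * k}. swing_coloring k i u = c}"
  have "?S (Suc i) (other (col i)) = insert i (?S i (other (col i)))"
    and "?S (Suc i) (col i) = ?S i (col i) - {i}"
    using Suc.prems by (auto simp: swing_coloring_def less_Suc_eq)
  moreover have "i \<in> ?S i (col i)" "i \<notin> ?S i (other (col i))"
    using Suc.prems by (auto simp: swing_coloring_def)
  ultimately show ?case
    using Suc by simp
qed

text \<open>All \<open>k\<close> nodes of \<open>Y\<close> oppose node \<open>i\<close> here, but
  its \<open>k + 1\<close> fixed neighbors share its color and outnumber them.\<close>

lemma switchable_control:
  assumes "i \<le> 2 * k"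
  shows "switchable (swing_graph k) (swing_coloring k i) i"
proof -
  let ?N = "neighbors (swing_graph k) i"
  have i: "swing_coloring k i i = col i"
    using assms by (simp add: swing_coloring_def)
  have opposite: "{u \<in> ?N. swing_coloring k i u = other (col i)} = {2 * k <..3 * k}"
    using assms by (auto simp: neighbors_control swing_coloring_def col_def split: if_splits)
  have same: "{u \<in> ?N. swing_coloring k i u = col i} =
      {y. 3 * k + 1 \<le> y \<and> y < (3 * k + 1) + 2 * (k + 1) \<and> even y = even i}"
    using assms by (auto simp: neighbors_control swing_coloring_def col_eq_iff)
  have "i \<in> pverts (swing_graph k)"
    using assms by (simp add: swing_graph_def)
  then show ?thesis
    unfolding switchable_def i opposite same card_parity_interval by simp
qed

text \<open>Once node \<open>i\<close> has switched, \<open>X\<close> is colored as at the end of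
  the round, and its majority, \<open>k + 1\<close> against \<open>k\<close>, is the color that
  \<open>Y\<close> still has.\<close>

lemma switchable_follower:
  assumes "i < 2 * k" "2 * k < y" "y \<le> 3 * k"
  shows "switchable (swing_graph k) (switch {i} (swing_coloring k i)) y"
proof -
  let ?f = "switch {i} (swing_coloring k i)"
  have y: "?f y = col (Suc i)"
    using assms by (simp add: switch_def swing_coloring_def)
  have "{u \<in> {..2 * k}. ?f u = c} = {u \<in> {..2 * k}. swing_coloring k (Suc i) u = c}" for c
    using assms by (auto simp: switch_def swing_coloring_def less_Suc_eq)
  then show ?thesis
    using card_control_colors[of "Suc i" k] assms
    unfolding switchable_def y neighbors_follower[OF assms(2,3)]
    by (simp add: swing_graph_def)
qed

lemma fold_switch_swing_round:
  assumes "i < 2 * k"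
  shows "fold switch (swing_round k i) (swing_coloring k i) = swing_coloring k (Suc i)"
proof -
  have "fold switch (swing_round k i) (swing_coloring k i) =
      switch (set (i # [2 * k + 1..<3 * k + 1])) (swing_coloring k i)"
    unfolding swing_round_def using assms by (intro fold_switch_singletons) simp
  also have "\<dots> = swing_coloring k (Suc i)"
    using assms by (auto simp: fun_eq_iff switch_def swing_coloring_def)
  finally show ?thesis .
qed

lemma valid_steps_swing_round:
  assumes "i < 2 * k"
  shows "valid_steps (swing_graph k) (swing_coloring k i) (swing_round k i)"
proof -
  have "valid_steps (swing_graph k) (switch {i} (swing_coloring k i))
      (map (\<lambda>v. {v}) [2 * k + 1..<3 * k + 1])"
    using assms
    by (intro valid_steps_independent) (auto simp: switchable_follower neighbors_follower)
  then show ?thesis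
    using assms by (simp add: swing_round_def switchable_control)
qed

lemma valid_steps_swing_rounds:
  assumes "i \<le> 2 * k"
  shows "valid_steps (swing_graph k) (swing_coloring k 0) (concat (map (swing_round k) [0..<i])) \<and>
    fold switch (concat (map (swing_round k) [0..<i])) (swing_coloring k 0) = swing_coloring k i"
  using assms
  by (induction i)
    (simp_all add: valid_steps_append valid_steps_swing_round fold_switch_swing_round)

lemma sequential_steps_swing:
  "\<exists>Ss. sequential_steps (swing_graph k) (swing_coloring k 0) Ss \<and> length Ss = 2 * k * (k + 1)"
proof (intro exI conjI)
  \<comment> \<open>The rounds are \<open>0\<close> to \<open>2 * k - 1\<close>, so node
    \<open>2 * k\<close> never moves.\<close>
  let ?Ss = "concat (map (swing_round k) [0..<2 * k])"
  show "sequential_steps (swing_graph k) (swing_coloring k 0) ?Ss"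
    using valid_steps_swing_rounds[of "2 * k" k]
    by (auto simp: sequential_steps_def swing_round_def)
  have "length (swing_round k i) = k + 1" for i
    by (simp add: swing_round_def)
  then show "length ?Ss = 2 * k * (k + 1)"
    by (simp add: length_concat comp_def sum_list_triv)
qed

theorem theorem1:
  shows "\<exists>c::real. c > 0 \<and>
    (\<exists>\<^sub>\<infinity>n::nat. \<exists>(G :: nat pair_pre_digraph) (f :: nat \<Rightarrow> color).
       pair_graph G \<and> card (pverts G) = n \<and>
       (\<exists>Ss. sequential_steps G f Ss \<and> real (length Ss) \<ge> c * (real n)\<^sup>2))"
\<comment> \<open>For \<open>k \<ge> 1\<close> the order \<open>n = 5k + 3\<close> is at most
  \<open>8k\<close>, hence \<open>n^2 / 32 \<le> 2k^2 \<le> 2k(k + 1)\<close>.\<close>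
proof (intro exI[of _ "1 / 32"] conjI, simp, unfold INFM_nat, intro allI)
  fix m :: nat
  define k where "k = Suc m"
  obtain Ss where Ss: "sequential_steps (swing_graph k) (swing_coloring k 0) Ss"
    "length Ss = 2 * k * (k + 1)"
    using sequential_steps_swing by blast
  have "(real (5 * k + 3))\<^sup>2 \<le> (8 * real k)\<^sup>2"
    by (intro power_mono) (auto simp: k_def)
  then have "1 / 32 * (real (5 * k + 3))\<^sup>2 \<le> real (length Ss)"
    unfolding Ss(2) by (simp add: power2_eq_square algebra_simps)
  moreover have "card (pverts (swing_graph k)) = 5 * k + 3"
    by (simp add: swing_graph_def)
  moreover have "m < 5 * k + 3"
    by (simp add: k_def)
  ultimately show "\<exists>n>m. \<exists>(G :: nat pair_pre_digraph) (f :: nat \<Rightarrow> color).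
      pair_graph G \<and> card (pverts G) = n \<and>
      (\<exists>Ss. sequential_steps G f Ss \<and> 1 / 32 * (real n)\<^sup>2 \<le> real (length Ss))"
    using pair_graph_swing_graph[of k] Ss(1) by blast
qed

end
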